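(* Let $R$ be a unital commutative ring and let $\mathcal A$ be a commutative $R$-algebra that is torsion-free as a $\mathbb Z$-module. Let $\phi$ be an $R$-algebra endomorphism of $\mathcal A$ such that $\phi^i=\phi^j$ for some $1\le i<j$. Set $\delta:=\mathrm I-\phi$ and $\operatorname{Ker}_{\ge1}\phi:=\sum_{k\ge1}\operatorname{Ker}\phi^k$. Then $$\mathfrak r(\operatorname{Im}\delta)=\mathfrak r(\operatorname{Ker}\phi^i)=\mathfrak r(\operatorname{Ker}_{\ge1}\phi).$$ Consequently, $\operatorname{Im}\delta$ is a Mathieu subspace of $\mathcal A$.
   Context: $\mathrm I$ denotes the identity map of $\mathcal A$. Torsion-free as a $\mathbb Z$-module means that for $0\ne m\in\mathbb Z$ and $a\in\mathcal A$, $ma=0$ implies $a=0$. For an $R$-submodule $V$ of $\mathcal A$, the radical $\mathfrak r(V)$ is the set of $a\in\mathcal A$ such that $a^m\in V$ for all sufficiently large $m$. $V$ is a (two-sided) Mathieu subspace of $\mathcal A$ if for all $a,b,c\in\mathcal A$ with $a^m\in V$ for all $m\ge1$, one has $ba^mc\in V$ for all sufficiently large $m$. *)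

theory Defs
  imports "HOL-Algebra.AbelCoset" "HOL-Algebra.Module"
begin

text \<open>
  Algebras are not assumed to have an identity element, and endomorphisms are not assumed to
  preserve one if it exists; the field \<open>one\<close> of the record \<open>A\<close> is therefore
  unconstrained and never used. A unital commutative algebra in the sense of
  \<^locale>\<open>algebra\<close> is a special case.
\<close>

locale nonunital_comm_algebra = module R A for R (structure) and A (structure) +
  assumes mult_closed: "x \<in> carrier A \<Longrightarrow> y \<in> carrier A \<Longrightarrow> x \<otimes>\<^bsub>A\<^esub> y \<in> carrier A"
    and mult_assoc: "x \<in> carrier A \<Longrightarrow> y \<in> carrier A \<Longrightarrow> z \<in> carrier A \<Longrightarrow>
      (x \<otimes>\<^bsub>A\<^esub> y) \<otimes>\<^bsub>A\<^esub> z = x \<otimes>\<^bsub>A\<^esub> (y \<otimes>\<^bsub>A\<^esub> z)"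
    and mult_comm: "x \<in> carrier A \<Longrightarrow> y \<in> carrier A \<Longrightarrow> x \<otimes>\<^bsub>A\<^esub> y = y \<otimes>\<^bsub>A\<^esub> x"
    and mult_l_distr: "x \<in> carrier A \<Longrightarrow> y \<in> carrier A \<Longrightarrow> z \<in> carrier A \<Longrightarrow>
      (x \<oplus>\<^bsub>A\<^esub> y) \<otimes>\<^bsub>A\<^esub> z = x \<otimes>\<^bsub>A\<^esub> z \<oplus>\<^bsub>A\<^esub> y \<otimes>\<^bsub>A\<^esub> z"
    and smult_mult: "r \<in> carrier R \<Longrightarrow> x \<in> carrier A \<Longrightarrow> y \<in> carrier A \<Longrightarrow>
      (r \<odot>\<^bsub>A\<^esub> x) \<otimes>\<^bsub>A\<^esub> y = r \<odot>\<^bsub>A\<^esub> (x \<otimes>\<^bsub>A\<^esub> y)"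

lemma algebra_imp_nonunital_comm_algebra:
  assumes "algebra R A"
  shows "nonunital_comm_algebra R A"
proof -
  have A: "cring A"
    using assms by (rule algebra.M_cring)
  have cm: "comm_monoid A" and ring: "ring A"
    using cring.axioms[OF A] by blast+
  have m: "Group.monoid A"
    using cm by (rule comm_monoid.axioms)
  show ?thesis
  proof (intro nonunital_comm_algebra.intro nonunital_comm_algebra_axioms.intro)
    show "module R A"
      using assms by (rule algebra.module)
  qed (fact monoid.m_closed[OF m] monoid.m_assoc[OF m] comm_monoid.m_comm[OF cm]
    ring.ring_simprules(13)[OF ring] algebra.smult_assoc2[OF assms])+
qed

definition torsion_free :: "('a, 'm) ring_scheme \<Rightarrow> bool" where
  "torsion_free A \<longleftrightarrow>
     (\<forall>m::int. \<forall>a \<in> carrier A. m \<noteq> 0 \<longrightarrow> [m] \<cdot>\<^bsub>A\<^esub> a = \<zero>\<^bsub>A\<^esub> \<longrightarrow> a = \<zero>\<^bsub>A\<^esub>)"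

definition algebra_endo ::
  "('r, 's) ring_scheme \<Rightarrow> ('r, 'a, 'm) module_scheme \<Rightarrow> ('a \<Rightarrow> 'a) \<Rightarrow> bool" where
  "algebra_endo R A \<phi> \<longleftrightarrow>
     \<phi> \<in> hom (add_monoid A) (add_monoid A) \<and> \<phi> \<in> hom A A \<and>
     (\<forall>r \<in> carrier R. \<forall>a \<in> carrier A. \<phi> (r \<odot>\<^bsub>A\<^esub> a) = r \<odot>\<^bsub>A\<^esub> \<phi> a)"

text \<open>
  The power \<open>a\<^sup>m\<close> for \<open>m \<ge> 1\<close>, without reference to an identity element (the library's
  \<open>[^]\<close> starts from \<open>one\<close>). The value at \<open>m = 0\<close> is junk; below only \<open>m \<ge> 1\<close> occurs.
\<close>

definition pos_pow :: "('a, 'm) monoid_scheme \<Rightarrow> 'a \<Rightarrow> nat \<Rightarrow> 'a" where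
  "pos_pow A a m = ((\<lambda>x. x \<otimes>\<^bsub>A\<^esub> a) ^^ (m - 1)) a"

lemma (in monoid) pos_pow_eq_nat_pow:
  assumes "a \<in> carrier G" and "m \<ge> 1"
  shows "pos_pow G a m = a [^] m"
proof -
  have "((\<lambda>x. x \<otimes> a) ^^ n) a = a [^] Suc n" for n
    by (induction n) (use assms in auto)
  from this[of "m - 1"] show ?thesis
    using assms by (simp add: pos_pow_def)
qed

definition radical :: "('a, 'm) ring_scheme \<Rightarrow> 'a set \<Rightarrow> 'a set" where
  "radical A V = {a \<in> carrier A. \<exists>N\<ge>1. \<forall>m\<ge>N. pos_pow A a m \<in> V}"

definition mathieu_subspace ::
  "('r, 's) ring_scheme \<Rightarrow> ('r, 'a, 'm) module_scheme \<Rightarrow> 'a set \<Rightarrow> bool" where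
  "mathieu_subspace R A V \<longleftrightarrow> submodule V R A \<and>
     (\<forall>a \<in> carrier A. \<forall>b \<in> carrier A. \<forall>c \<in> carrier A.
        (\<forall>m\<ge>1. pos_pow A a m \<in> V) \<longrightarrow>
        (\<exists>N\<ge>1. \<forall>m\<ge>N. b \<otimes>\<^bsub>A\<^esub> pos_pow A a m \<otimes>\<^bsub>A\<^esub> c \<in> V))"

definition id_minus :: "('a, 'm) ring_scheme \<Rightarrow> ('a \<Rightarrow> 'a) \<Rightarrow> 'a \<Rightarrow> 'a" where
  "id_minus A \<phi> a = a \<ominus>\<^bsub>A\<^esub> \<phi> a"

text \<open>The sum of the submodules \<open>Ker \<phi>\<^sup>k\<close>, \<open>k \<ge> 1\<close>, as the set of finite sums of their elements.\<close>

definition Ker_ge1 :: "('a, 'm) ring_scheme \<Rightarrow> ('a \<Rightarrow> 'a) \<Rightarrow> 'a set" where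
  "Ker_ge1 A \<phi> = {\<Oplus>\<^bsub>A\<^esub>k\<in>F. f k | F f.
     finite F \<and> F \<subseteq> {1::nat..} \<and> (\<forall>k\<in>F. f k \<in> a_kernel A A (\<phi> ^^ k))}"

end

theory Submission
  imports Defs
begin

text \<open>
  Write \<open>d = j - i\<close>. On the image of \<open>\<phi>\<^sup>i\<close> the map \<open>\<phi>\<^sup>d\<close> is the identity, so the trace
  \<open>1 + \<phi> + \<dots> + \<phi>\<^bsup>d-1\<^esup>\<close> kills \<open>\<phi>\<^sup>i (Im \<delta>)\<close>. If all powers of \<open>a\<close> lie in \<open>Im \<delta>\<close>
  (replace \<open>a\<close> by \<open>a\<^sup>N\<close> when only all large ones do), all power sums of the conjugates
  of \<open>\<phi>\<^sup>i a\<close> therefore vanish; by Newton's identities and torsion-freeness so do their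
  elementary symmetric functions, and the conjugates are nilpotent. Hence a power of \<open>a\<close>
  lies in some \<open>Ker \<phi>\<^sup>k\<close>. Conversely \<open>Ker \<phi>\<^sup>k \<subseteq> Ker \<phi>\<^sup>i\<close> for all \<open>k\<close>, and \<open>Ker \<phi>\<^sup>i\<close> is an ideal
  contained in \<open>Im \<delta>\<close>, because \<open>a - \<phi>\<^sup>n a\<close> telescopes.
\<close>

lemma radical_mono: "V \<subseteq> W \<Longrightarrow> radical A V \<subseteq> radical A W"
  unfolding radical_def by blast

section \<open>Commutative rings without identity and their positive powers\<close>

locale nonunital_cring = abelian_group A for A (structure) +
  assumes mult_closed [intro, simp]:
      "x \<in> carrier A \<Longrightarrow> y \<in> carrier A \<Longrightarrow> x \<otimes> y \<in> carrier A"
    and mult_assoc: "x \<in> carrier A \<Longrightarrow> y \<in> carrier A \<Longrightarrow> z \<in> carrier A \<Longrightarrow>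
      (x \<otimes> y) \<otimes> z = x \<otimes> (y \<otimes> z)"
    and mult_comm: "x \<in> carrier A \<Longrightarrow> y \<in> carrier A \<Longrightarrow> x \<otimes> y = y \<otimes> x"
    and l_distr: "x \<in> carrier A \<Longrightarrow> y \<in> carrier A \<Longrightarrow> z \<in> carrier A \<Longrightarrow>
      (x \<oplus> y) \<otimes> z = x \<otimes> z \<oplus> y \<otimes> z"
begin

lemma r_distr:
  assumes "x \<in> carrier A" "y \<in> carrier A" "z \<in> carrier A"
  shows "z \<otimes> (x \<oplus> y) = z \<otimes> x \<oplus> z \<otimes> y"
  using assms by (simp add: mult_comm[of z] l_distr)

lemma l_null [simp]: "x \<in> carrier A \<Longrightarrow> \<zero> \<otimes> x = \<zero>"
  using l_distr[of \<zero> \<zero> x] by (metis add.l_cancel_one' l_zero mult_closed zero_closed)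

lemma r_null [simp]: "x \<in> carrier A \<Longrightarrow> x \<otimes> \<zero> = \<zero>"
  by (simp add: mult_comm[of x \<zero>])

lemma minus_zero_right: "x \<in> carrier A \<Longrightarrow> x \<ominus> \<zero> = x"
  by (simp add: a_minus_def minus_equality[of \<zero> \<zero>])

lemma pos_pow_1 [simp]: "pos_pow A a (Suc 0) = a"
  by (simp add: pos_pow_def)

lemma pos_pow_Suc: "m \<ge> 1 \<Longrightarrow> pos_pow A a (Suc m) = pos_pow A a m \<otimes> a"
  by (cases m) (simp_all add: pos_pow_def)

lemma pos_pow_closed [intro, simp]:
  assumes "a \<in> carrier A"
  shows "pos_pow A a m \<in> carrier A"
proof -
  have "((\<lambda>x. x \<otimes> a) ^^ n) a \<in> carrier A" for n
    by (induction n) (use assms in auto)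
  then show ?thesis by (simp add: pos_pow_def)
qed

lemma pos_pow_add:
  assumes "a \<in> carrier A" "m \<ge> 1" "n \<ge> 1"
  shows "pos_pow A a (m + n) = pos_pow A a m \<otimes> pos_pow A a n"
  using assms(3) by (induction n rule: dec_induct) (use assms(1,2) in \<open>simp_all add: pos_pow_Suc mult_assoc\<close>)

lemma pos_pow_mult:
  assumes "a \<in> carrier A" "m \<ge> 1" "n \<ge> 1"
  shows "pos_pow A (pos_pow A a m) n = pos_pow A a (m * n)"
  using assms(3)
proof (induction n rule: dec_induct)
  case (step n)
  have "pos_pow A a (m * Suc n) = pos_pow A a (m * n) \<otimes> pos_pow A a m"
    using pos_pow_add[OF assms(1), of "m * n" m] assms(2) step(1) by (simp add: add.commute)
  then show ?case using step by (simp add: pos_pow_Suc)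
qed simp

lemma mult_right_funpow_closed [simp]:
  "x \<in> carrier A \<Longrightarrow> u \<in> carrier A \<Longrightarrow> ((\<lambda>v. v \<otimes> x) ^^ m) u \<in> carrier A"
  by (induction m) auto

lemma mult_right_funpow_mult:
  assumes "x \<in> carrier A" "y \<in> carrier A" "u \<in> carrier A"
  shows "((\<lambda>v. v \<otimes> x) ^^ m) (u \<otimes> y) = ((\<lambda>v. v \<otimes> x) ^^ m) u \<otimes> y"
proof (induction m)
  case (Suc m)
  then show ?case
    using assms mult_assoc[of "((\<lambda>v. v \<otimes> x) ^^ m) u" x y] mult_comm[of x y]
      mult_assoc[of "((\<lambda>v. v \<otimes> x) ^^ m) u" y x] by simp
qed simp

text \<open>The iterate stands for \<open>u\<close> times the \<open>m\<close>-th power of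
  \<open>x\<close> and yields \<open>u\<close> at \<open>m = 0\<close>. The product with
  \<open>pos_pow\<close> agrees only from \<open>m = 1\<close> on, hence the hypothesis.\<close>

lemma mult_right_funpow_pos_pow:
  assumes "x \<in> carrier A" "u \<in> carrier A" "m \<ge> 1"
  shows "((\<lambda>v. v \<otimes> x) ^^ m) u = u \<otimes> pos_pow A x m"
  using assms(3)
  by (induction m rule: dec_induct) (use assms(1,2) in \<open>simp_all add: pos_pow_Suc mult_assoc\<close>)

section \<open>Symmetric functions with a multiplier and Newton's identities\<close>

text \<open>
  Since \<open>A\<close> has no unit, the symmetric functions of a list are replaced by their products with
  an element \<open>u\<close>: \<open>esym r xs u = e\<^sub>r(xs) u\<close>, \<open>psum m xs u = p\<^sub>m(xs) u\<close>, and \<open>hook r m xs u\<close> is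
  \<open>u\<close> times the sum of \<open>x\<^sub>k\<^sup>m \<Prod>\<^bsub>s\<in>S\<^esub> x\<^sub>s\<close> over the index sets \<open>S\<close> of size \<open>r\<close> and all \<open>k \<notin> S\<close>.
\<close>

fun esym :: "nat \<Rightarrow> 'a list \<Rightarrow> 'a \<Rightarrow> 'a" where
  "esym 0 xs u = u"
| "esym (Suc r) [] u = \<zero>"
| "esym (Suc r) (x # xs) u = esym (Suc r) xs u \<oplus> esym r xs (u \<otimes> x)"

fun psum :: "nat \<Rightarrow> 'a list \<Rightarrow> 'a \<Rightarrow> 'a" where
  "psum m [] u = \<zero>"
| "psum m (x # xs) u = psum m xs u \<oplus> ((\<lambda>v. v \<otimes> x) ^^ m) u"

fun hook :: "nat \<Rightarrow> nat \<Rightarrow> 'a list \<Rightarrow> 'a \<Rightarrow> 'a" where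
  "hook r m [] u = \<zero>"
| "hook 0 m (x # xs) u = hook 0 m xs u \<oplus> ((\<lambda>v. v \<otimes> x) ^^ m) u"
| "hook (Suc r) m (x # xs) u =
     (hook (Suc r) m xs u \<oplus> hook r m xs (u \<otimes> x)) \<oplus> esym (Suc r) xs (((\<lambda>v. v \<otimes> x) ^^ m) u)"

lemma esym_closed [simp]:
  "set xs \<subseteq> carrier A \<Longrightarrow> u \<in> carrier A \<Longrightarrow> esym r xs u \<in> carrier A"
  by (induction r xs u rule: esym.induct) auto

lemma psum_closed [simp]:
  "set xs \<subseteq> carrier A \<Longrightarrow> u \<in> carrier A \<Longrightarrow> psum m xs u \<in> carrier A"
  by (induction m xs u rule: psum.induct) auto

lemma hook_closed [simp]:
  "set xs \<subseteq> carrier A \<Longrightarrow> u \<in> carrier A \<Longrightarrow> hook r m xs u \<in> carrier A"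
  by (induction r m xs u rule: hook.induct) auto

lemma esym_add:
  "set xs \<subseteq> carrier A \<Longrightarrow> u \<in> carrier A \<Longrightarrow> v \<in> carrier A \<Longrightarrow>
   esym r xs (u \<oplus> v) = esym r xs u \<oplus> esym r xs v"
proof (induction r xs u arbitrary: v rule: esym.induct)
  case (3 r x xs u)
  then have "esym (Suc r) xs (u \<oplus> v) = esym (Suc r) xs u \<oplus> esym (Suc r) xs v"
    and "esym r xs (u \<otimes> x \<oplus> v \<otimes> x) = esym r xs (u \<otimes> x) \<oplus> esym r xs (v \<otimes> x)"
    by auto
  then show ?case using 3(3-5) by (simp add: l_distr a_ac)
qed auto

lemma esym_mult:
  "set xs \<subseteq> carrier A \<Longrightarrow> u \<in> carrier A \<Longrightarrow> y \<in> carrier A \<Longrightarrow>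
   esym r xs (u \<otimes> y) = esym r xs u \<otimes> y"
proof (induction r xs u rule: esym.induct)
  case (3 r x xs u)
  have "esym r xs (u \<otimes> y \<otimes> x) = esym r xs (u \<otimes> x \<otimes> y)"
    using 3(3-5) by (simp add: mult_assoc mult_comm[of x y])
  then show ?case using 3 by (simp add: l_distr)
qed auto

lemma psum_mult:
  "set xs \<subseteq> carrier A \<Longrightarrow> u \<in> carrier A \<Longrightarrow> y \<in> carrier A \<Longrightarrow>
   psum m xs (u \<otimes> y) = psum m xs u \<otimes> y"
  by (induction m xs u rule: psum.induct) (auto simp: l_distr mult_right_funpow_mult)

lemma esym_zero:
  assumes "set xs \<subseteq> carrier A"
  shows "esym r xs \<zero> = \<zero>"
  using esym_mult[OF assms, of \<zero> \<zero> r] assms by simp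

lemma esym_beyond_length: "r > length xs \<Longrightarrow> set xs \<subseteq> carrier A \<Longrightarrow> u \<in> carrier A \<Longrightarrow> esym r xs u = \<zero>"
  by (induction r xs u rule: esym.induct) auto

lemma hook_0:
  "set xs \<subseteq> carrier A \<Longrightarrow> u \<in> carrier A \<Longrightarrow> hook 0 m xs u = psum m xs u"
  by (induction xs) auto

text \<open>Expand the product of the elementary symmetric function and the power sum over pairs of
  a set \<open>T\<close> of size \<open>Suc r\<close> and an index \<open>k\<close>. Pairs with
  \<open>k\<close> outside \<open>T\<close> give the first hook. If \<open>k\<close> lies in
  \<open>T\<close>, moving it out leaves a set of size \<open>r\<close> and raises the exponent to
  \<open>Suc m\<close>.\<close>

lemma esym_psum:
  "set xs \<subseteq> carrier A \<Longrightarrow> u \<in> carrier A \<Longrightarrow>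
   esym (Suc r) xs (psum m xs u) = hook (Suc r) m xs u \<oplus> hook r (Suc m) xs u"
proof (induction xs arbitrary: r u)
  case (Cons x xs)
  have c: "x \<in> carrier A" "set xs \<subseteq> carrier A" "u \<in> carrier A" using Cons by auto
  let ?p = "psum m xs u" and ?q = "((\<lambda>v. v \<otimes> x) ^^ m) u"
  have lhs: "esym (Suc r) (x # xs) (psum m (x # xs) u) =
     (esym (Suc r) xs ?p \<oplus> esym (Suc r) xs ?q) \<oplus> (esym r xs (psum m xs (u \<otimes> x)) \<oplus> esym r xs (?q \<otimes> x))"
    using c by (simp add: esym_add l_distr psum_mult)
  have IH: "esym (Suc r) xs ?p = hook (Suc r) m xs u \<oplus> hook r (Suc m) xs u"
    using Cons.IH c by simp
  show ?case
  proof (cases r)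
    case 0
    then show ?thesis using c lhs IH by (simp add: hook_0 a_ac)
  next
    case (Suc s)
    have "esym r xs (psum m xs (u \<otimes> x)) = hook r m xs (u \<otimes> x) \<oplus> hook s (Suc m) xs (u \<otimes> x)"
      using Cons.IH c Suc by simp
    then show ?thesis using c lhs IH Suc by (simp add: a_ac del: esym.simps)
  qed
qed simp

text \<open>A set of \<open>Suc r\<close> indices splits into a set of size \<open>r\<close> and one
  further index in \<open>Suc r\<close> ways, so every monomial is counted that often.\<close>

lemma hook_1:
  "set xs \<subseteq> carrier A \<Longrightarrow> u \<in> carrier A \<Longrightarrow> hook r 1 xs u = [Suc r] \<cdot> esym (Suc r) xs u"
proof (induction xs arbitrary: r u)
  case Nil
  then show ?case by simp
next
  case (Cons x xs)
  have c: "x \<in> carrier A" "set xs \<subseteq> carrier A" "u \<in> carrier A" using Cons by auto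
  show ?case
  proof (cases r)
    case 0
    then show ?thesis using c Cons.IH[of u 0] by simp
  next
    case (Suc s)
    show ?thesis
      using c Cons.IH[of u r] Cons.IH[of "u \<otimes> x" s] Suc
      by (simp add: add.nat_pow_distrib a_ac)
  qed
qed


lemma torsion_free_natD:
  assumes "torsion_free A" "n \<ge> 1" "x \<in> carrier A" "[(n::nat)] \<cdot> x = \<zero>"
  shows "x = \<zero>"
proof -
  have "[int n] \<cdot> x = \<zero>" using assms(4) by (simp add: add_pow_int_ge)
  then show ?thesis
    using assms(1-3) unfolding torsion_free_def by (metis of_nat_eq_0_iff not_one_le_zero)
qed

lemma esym_eq_zero_if_psum_eq_zero:
  assumes "torsion_free A" and xs: "set xs \<subseteq> carrier A" and u: "u \<in> carrier A"
    and p: "\<And>m. m \<ge> 1 \<Longrightarrow> psum m xs u = \<zero>" and "r \<ge> 1"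
  shows "esym r xs u = \<zero>"
proof -
  \<comment> \<open>With vanishing power sums, \<open>esym_psum\<close> makes
    \<open>hook (Suc s) m\<close> the negative of \<open>hook s (Suc m)\<close>. The induction on
    \<open>s\<close> therefore runs over all \<open>m\<close> at once and ends at a power
    sum.\<close>
  have "hook s m xs u = \<zero>" if "m \<ge> 1" for s m
    using that
  proof (induction s arbitrary: m)
    case 0
    then show ?case using p xs u by (simp add: hook_0)
  next
    case (Suc s)
    have "hook (Suc s) m xs u \<oplus> hook s (Suc m) xs u = \<zero>"
      using esym_psum[OF xs u, of s m] p[OF Suc.prems] esym_zero[OF xs] by simp
    then show ?case using Suc.IH[of "Suc m"] xs u by simp
  qed
  then have "[r] \<cdot> esym r xs u = \<zero>"
    using hook_1[OF xs u, of "r - 1"] \<open>r \<ge> 1\<close> by simp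
  then show ?thesis
    using torsion_free_natD[OF assms(1) \<open>r \<ge> 1\<close>] xs u by simp
qed

text \<open>With a unit, \<open>x\<close> would be a root of the monic polynomial with roots
  \<open>x # xs\<close>, whose lower coefficients all vanish. Here the multiplier starts as
  \<open>x\<close> and gathers further factors \<open>x\<close> as \<open>x\<close> is split off
  from the list.\<close>

lemma nilpotent_if_psum_eq_zero:
  assumes "torsion_free A" and x: "x \<in> carrier A" and xs: "set xs \<subseteq> carrier A"
    and p: "\<And>m. m \<ge> 1 \<Longrightarrow> psum m (x # xs) x = \<zero>"
  shows "\<exists>n\<ge>1. pos_pow A x n = \<zero>"
proof -
  let ?n = "Suc (length xs)"
  let ?v = "\<lambda>k. ((\<lambda>v. v \<otimes> x) ^^ k) x"
  have v: "?v k = x \<otimes> pos_pow A x k" if "k \<ge> 1" for k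
    using mult_right_funpow_pos_pow[OF x x that] .
  \<comment> \<open>Vanishing with multiplier \<open>x\<close> passes to all its multiples by
    \<open>esym_mult\<close>. The case \<open>k = 0\<close> is separate because there
    \<open>?v k\<close> is \<open>x\<close> itself.\<close>
  have e: "esym (Suc r) (x # xs) (?v k) = \<zero>" for r k
  proof -
    have "esym (Suc r) (x # xs) x = \<zero>"
      using esym_eq_zero_if_psum_eq_zero[OF assms(1) _ x p, of "Suc r"] x xs by simp
    then show ?thesis
      using esym_mult[of "x # xs" x "pos_pow A x k" "Suc r"] v[of k] x xs
      by (cases k) (simp_all del: esym.simps funpow.simps)
  qed
  \<comment> \<open>The degree exceeds the length of \<open>xs\<close> at \<open>k = 0\<close>.
    Splitting \<open>x\<close> off in \<open>e\<close> then lowers the degree by one and multiplies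
    by \<open>x\<close>; degree 0 leaves the bare power \<open>?v ?n\<close>.\<close>
  have "esym (?n - k) xs (?v k) = \<zero>" if "k \<le> ?n" for k
    using that
  proof (induction k)
    case 0
    then show ?case using x xs by (simp add: esym_beyond_length del: esym.simps)
  next
    case (Suc k)
    let ?r = "?n - Suc k"
    have "esym (Suc ?r) xs (?v k) = \<zero>"
      using Suc by (simp add: Suc_diff_le del: esym.simps)
    then show ?case using e[of ?r k] x xs by simp
  qed
  from this[of ?n] have "pos_pow A x (Suc ?n) = \<zero>"
    by (simp add: pos_pow_def)
  then show ?thesis by (metis le_add1 plus_1_eq_Suc)
qed

end

section \<open>Endomorphisms, their kernels and telescoping sums\<close>

locale nonunital_cring_endo = nonunital_cring +
  fixes \<phi> :: "'a \<Rightarrow> 'a"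
  assumes endo_closed [simp]: "x \<in> carrier A \<Longrightarrow> \<phi> x \<in> carrier A"
    and endo_add: "x \<in> carrier A \<Longrightarrow> y \<in> carrier A \<Longrightarrow> \<phi> (x \<oplus> y) = \<phi> x \<oplus> \<phi> y"
    and endo_mult: "x \<in> carrier A \<Longrightarrow> y \<in> carrier A \<Longrightarrow> \<phi> (x \<otimes> y) = \<phi> x \<otimes> \<phi> y"
begin

text \<open>Makes the facts of this locale, such as \<open>kernel_ideal\<close> and
  \<open>endo_pos_pow\<close>, available for every iterate of \<phi>.\<close>

lemma endo_funpow: "nonunital_cring_endo A (\<phi> ^^ n)"
proof (induction n)
  case (Suc n)
  then interpret f: nonunital_cring_endo A "\<phi> ^^ n" .
  show ?case
    by unfold_locales (simp_all add: endo_add endo_mult f.endo_add f.endo_mult)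
qed (unfold_locales, auto)

lemma endo_zero [simp]: "\<phi> \<zero> = \<zero>"
  using endo_add[of \<zero> \<zero>] by (metis add.l_cancel_one' endo_closed l_zero zero_closed)

lemma endo_inv: "x \<in> carrier A \<Longrightarrow> \<phi> (\<ominus> x) = \<ominus> \<phi> x"
  using endo_add[of "\<ominus> x" x] by (simp add: l_neg minus_equality)

lemma endo_minus: "x \<in> carrier A \<Longrightarrow> y \<in> carrier A \<Longrightarrow> \<phi> (x \<ominus> y) = \<phi> x \<ominus> \<phi> y"
  by (simp add: a_minus_def endo_add endo_inv)

lemma endo_pos_pow:
  assumes "x \<in> carrier A" "m \<ge> 1"
  shows "\<phi> (pos_pow A x m) = pos_pow A (\<phi> x) m"
  using assms(2) by (induction m rule: dec_induct) (use assms(1) in \<open>simp_all add: pos_pow_Suc endo_mult\<close>)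

lemma mem_a_kernel: "x \<in> a_kernel A A \<phi> \<longleftrightarrow> x \<in> carrier A \<and> \<phi> x = \<zero>"
  by (auto simp: a_kernel_def kernel_def)

lemma kernel_ideal:
  assumes "x \<in> a_kernel A A \<phi>" "y \<in> carrier A"
  shows "x \<otimes> y \<in> a_kernel A A \<phi>" and "y \<otimes> x \<in> a_kernel A A \<phi>"
  using assms by (simp_all add: mem_a_kernel endo_mult)

lemma funpow_closed [simp]: "x \<in> carrier A \<Longrightarrow> (\<phi> ^^ n) x \<in> carrier A"
  by (induction n) auto

lemma id_minus_closed [simp]: "x \<in> carrier A \<Longrightarrow> id_minus A \<phi> x \<in> carrier A"
  by (simp add: id_minus_def)

lemma id_minus_add:
  "x \<in> carrier A \<Longrightarrow> y \<in> carrier A \<Longrightarrow> id_minus A \<phi> (x \<oplus> y) = id_minus A \<phi> x \<oplus> id_minus A \<phi> y"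
  by (simp add: id_minus_def a_minus_def endo_add minus_add a_ac)

lemma id_minus_zero [simp]: "id_minus A \<phi> \<zero> = \<zero>"
  by (simp add: id_minus_def a_minus_def)

lemma id_minus_inv: "x \<in> carrier A \<Longrightarrow> id_minus A \<phi> (\<ominus> x) = \<ominus> id_minus A \<phi> x"
  by (simp add: id_minus_def a_minus_def endo_inv minus_add)

lemma diff_trans:
  assumes "x \<in> carrier A" "y \<in> carrier A" "z \<in> carrier A"
  shows "(x \<ominus> y) \<oplus> (y \<ominus> z) = x \<ominus> z"
  using assms by (simp add: a_minus_def a_assoc r_neg1)

text \<open>Telescoping: a preimage is the sum of the iterates \<open>(\<phi> ^^ k) x\<close> over
  \<open>k < n\<close>.\<close>

lemma minus_funpow_in_image:
  assumes "x \<in> carrier A"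
  shows "x \<ominus> (\<phi> ^^ n) x \<in> id_minus A \<phi> ` carrier A"
proof (induction n)
  case 0
  have "x \<ominus> (\<phi> ^^ 0) x = id_minus A \<phi> \<zero>"
    using assms by (simp add: a_minus_def r_neg)
  then show ?case by (rule image_eqI) simp
next
  case (Suc n)
  then obtain w where w: "w \<in> carrier A" "x \<ominus> (\<phi> ^^ n) x = id_minus A \<phi> w" by blast
  have "x \<ominus> (\<phi> ^^ Suc n) x = (x \<ominus> (\<phi> ^^ n) x) \<oplus> ((\<phi> ^^ n) x \<ominus> (\<phi> ^^ Suc n) x)"
    using assms by (intro diff_trans[symmetric]) simp_all
  also have "(\<phi> ^^ n) x \<ominus> (\<phi> ^^ Suc n) x = id_minus A \<phi> ((\<phi> ^^ n) x)"
    by (simp add: id_minus_def)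
  also have "(x \<ominus> (\<phi> ^^ n) x) \<oplus> \<dots> = id_minus A \<phi> (w \<oplus> (\<phi> ^^ n) x)"
    unfolding w(2) using w(1) assms by (simp add: id_minus_add)
  finally show ?case by (rule image_eqI) (use w(1) assms in simp)
qed

lemma kernel_funpow_subset_image: "a_kernel A A (\<phi> ^^ n) \<subseteq> id_minus A \<phi> ` carrier A"
proof
  fix x assume "x \<in> a_kernel A A (\<phi> ^^ n)"
  then have x: "x \<in> carrier A" "(\<phi> ^^ n) x = \<zero>"
    using nonunital_cring_endo.mem_a_kernel[OF endo_funpow] by auto
  then show "x \<in> id_minus A \<phi> ` carrier A"
    using minus_funpow_in_image[OF x(1), of n] by (simp add: minus_zero_right)
qed

text \<open>The \<open>m\<close>-th power of \<open>(\<phi> ^^ k) b\<close> is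
  \<open>(\<phi> ^^ k) w \<ominus> (\<phi> ^^ Suc k) w\<close>, so the power sum telescopes.
  Reversing the index list lets the step from \<open>n\<close> to \<open>Suc n\<close> add a new
  head, as the recursion of \<open>psum\<close> requires.\<close>

lemma psum_orbit:
  assumes b: "b \<in> carrier A" and w: "w \<in> carrier A" and u: "u \<in> carrier A" and "m \<ge> 1"
    and bw: "pos_pow A b m = id_minus A \<phi> w"
  shows "psum m (map (\<lambda>k. (\<phi> ^^ k) b) (rev [0..<n])) u = u \<otimes> (w \<ominus> (\<phi> ^^ n) w)"
proof (induction n)
  case 0
  show ?case using w u by (simp add: a_minus_def r_neg)
next
  case (Suc n)
  interpret f: nonunital_cring_endo A "\<phi> ^^ n" by (rule endo_funpow)
  have "pos_pow A ((\<phi> ^^ n) b) m = (\<phi> ^^ n) (w \<ominus> \<phi> w)"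
    using f.endo_pos_pow[OF b \<open>m \<ge> 1\<close>] bw by (simp add: id_minus_def)
  also have "\<dots> = (\<phi> ^^ n) w \<ominus> (\<phi> ^^ Suc n) w"
    using w by (simp add: f.endo_minus funpow_swap1)
  finally have "((\<lambda>v. v \<otimes> (\<phi> ^^ n) b) ^^ m) u = u \<otimes> ((\<phi> ^^ n) w \<ominus> (\<phi> ^^ Suc n) w)"
    using mult_right_funpow_pos_pow[OF _ u \<open>m \<ge> 1\<close>, of "(\<phi> ^^ n) b"] b by simp
  then have "psum m (map (\<lambda>k. (\<phi> ^^ k) b) (rev [0..<Suc n])) u =
      u \<otimes> (w \<ominus> (\<phi> ^^ n) w) \<oplus> u \<otimes> ((\<phi> ^^ n) w \<ominus> (\<phi> ^^ Suc n) w)"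
    using Suc by simp
  also have "\<dots> = u \<otimes> ((w \<ominus> (\<phi> ^^ n) w) \<oplus> ((\<phi> ^^ n) w \<ominus> (\<phi> ^^ Suc n) w))"
    using u w by (intro r_distr[symmetric]) simp_all
  finally show ?case using diff_trans[of w "(\<phi> ^^ n) w" "(\<phi> ^^ Suc n) w"] w by simp
qed

section \<open>Endomorphisms with two equal iterates\<close>

context
  fixes i j :: nat
  assumes torsion_free: "torsion_free A" and ij: "i < j"
    and periodic: "\<And>a. a \<in> carrier A \<Longrightarrow> (\<phi> ^^ i) a = (\<phi> ^^ j) a"
begin

lemma funpow_add_period: "x \<in> carrier A \<Longrightarrow> (\<phi> ^^ (i + n * (j - i))) x = (\<phi> ^^ i) x"
proof (induction n)
  case (Suc n)
  have "i + Suc n * (j - i) = n * (j - i) + j" using ij by simp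
  then have "(\<phi> ^^ (i + Suc n * (j - i))) x = (\<phi> ^^ (n * (j - i))) ((\<phi> ^^ i) x)"
    using periodic[OF Suc.prems] by (metis comp_apply funpow_add)
  also have "\<dots> = (\<phi> ^^ (i + n * (j - i))) x"
    by (metis add.commute comp_apply funpow_add)
  finally show ?case using Suc by simp
qed simp

lemma kernel_funpow_stable: "a_kernel A A (\<phi> ^^ k) \<subseteq> a_kernel A A (\<phi> ^^ i)"
proof
  fix x assume "x \<in> a_kernel A A (\<phi> ^^ k)"
  then have x: "x \<in> carrier A" "(\<phi> ^^ k) x = \<zero>"
    using nonunital_cring_endo.mem_a_kernel[OF endo_funpow] by auto
  \<comment> \<open>Adding \<open>k\<close> periods to \<open>i\<close> leaves the iterate unchanged
    and, as the period is at least 1, takes the exponent to \<open>k\<close> or beyond.\<close>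
  let ?N = "i + k * (j - i)"
  have "k \<le> k * (j - i)" using ij by (cases "j - i") auto
  then have "k \<le> ?N" by (rule trans_le_add2)
  then have "(\<phi> ^^ ?N) x = (\<phi> ^^ (?N - k)) ((\<phi> ^^ k) x)"
    by (metis comp_apply funpow_add le_add_diff_inverse2)
  also have "\<dots> = \<zero>"
    using x nonunital_cring_endo.endo_zero[OF endo_funpow] by simp
  finally show "x \<in> a_kernel A A (\<phi> ^^ i)"
    using funpow_add_period x nonunital_cring_endo.mem_a_kernel[OF endo_funpow] by simp
qed

text \<open>By \<open>kernel_funpow_stable\<close> all summands lie in one kernel, which is closed
  under sums. Conversely, \<open>1 \<le> i\<close> makes \<open>{i}\<close> an admissible index
  set.\<close>

lemma Ker_ge1_eq:
  assumes "1 \<le> i"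
  shows "Ker_ge1 A \<phi> = a_kernel A A (\<phi> ^^ i)"
proof
  interpret f: nonunital_cring_endo A "\<phi> ^^ i" by (rule endo_funpow)
  show "Ker_ge1 A \<phi> \<subseteq> a_kernel A A (\<phi> ^^ i)"
  proof
    fix x assume "x \<in> Ker_ge1 A \<phi>"
    then obtain F :: "nat set" and g where F: "finite F" "x = (\<Oplus>k\<in>F. g k)"
      and g: "\<forall>k\<in>F. g k \<in> a_kernel A A (\<phi> ^^ k)"
      unfolding Ker_ge1_def by blast
    have "\<forall>k\<in>F. g k \<in> carrier A \<and> (\<phi> ^^ i) (g k) = \<zero>"
      using g kernel_funpow_stable f.mem_a_kernel by blast
    with \<open>finite F\<close> have "(\<Oplus>k\<in>F. g k) \<in> carrier A \<and> (\<phi> ^^ i) (\<Oplus>k\<in>F. g k) = \<zero>"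
    proof (induction F)
      case (insert k F)
      then have "(\<Oplus>l\<in>insert k F. g l) = g k \<oplus> (\<Oplus>l\<in>F. g l)"
        by (intro finsum_insert) auto
      then show ?case using insert f.endo_add by simp
    qed simp
    then show "x \<in> a_kernel A A (\<phi> ^^ i)" using F f.mem_a_kernel by simp
  qed
  show "a_kernel A A (\<phi> ^^ i) \<subseteq> Ker_ge1 A \<phi>"
  proof
    fix x assume x: "x \<in> a_kernel A A (\<phi> ^^ i)"
    then have "x = (\<Oplus>k\<in>{i}. (\<lambda>_. x) k)"
      using f.mem_a_kernel finsum_insert[of "{}" i "\<lambda>_. x"] by simp
    then show "x \<in> Ker_ge1 A \<phi>"
      unfolding Ker_ge1_def using x assms by fastforce
  qed
qed

lemma image_power_in_kernel:
  assumes a: "a \<in> carrier A" and im: "\<And>m. m \<ge> 1 \<Longrightarrow> pos_pow A a m \<in> id_minus A \<phi> ` carrier A"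
  shows "\<exists>n\<ge>1. pos_pow A a n \<in> a_kernel A A (\<phi> ^^ i)"
proof -
  interpret f: nonunital_cring_endo A "\<phi> ^^ i" by (rule endo_funpow)
  \<comment> \<open>Writing the period as \<open>Suc d\<close> exhibits the head
    \<open>(\<phi> ^^ d) ?b\<close> of the orbit list. This conjugate is the one shown to be
    nilpotent, so it also serves as the multiplier.\<close>
  obtain d where d: "j - i = Suc d" using ij by (metis Suc_diff_Suc)
  let ?b = "(\<phi> ^^ i) a"
  let ?xs = "map (\<lambda>k. (\<phi> ^^ k) ?b) (rev [0..<d])"
  have xs: "set ?xs \<subseteq> carrier A" using a by auto
  have psum: "psum m ((\<phi> ^^ d) ?b # ?xs) ((\<phi> ^^ d) ?b) = \<zero>" if m: "m \<ge> 1" for m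
  proof -
    obtain w where w: "w \<in> carrier A" "pos_pow A a m = id_minus A \<phi> w" using im[OF m] by blast
    let ?w = "(\<phi> ^^ i) w"
    have "pos_pow A ?b m = id_minus A \<phi> ?w"
      using f.endo_pos_pow[OF a m] w by (simp add: id_minus_def f.endo_minus funpow_swap1)
    then have "psum m (map (\<lambda>k. (\<phi> ^^ k) ?b) (rev [0..<Suc d])) ((\<phi> ^^ d) ?b) =
        (\<phi> ^^ d) ?b \<otimes> (?w \<ominus> (\<phi> ^^ Suc d) ?w)"
      using a w m by (intro psum_orbit) simp_all
    \<comment> \<open>\<open>?w\<close> lies in the image of \<open>\<phi> ^^ i\<close>, where a
      full period acts as the identity; the telescoped difference is thus zero.\<close>
    moreover have "(\<phi> ^^ Suc d) ?w = ?w"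
      using funpow_add_period[OF w(1), of 1] d
      by (metis add.commute comp_apply funpow_add mult_1)
    ultimately show ?thesis using a w by (simp add: a_minus_def r_neg)
  qed
  obtain n where n: "n \<ge> 1" "pos_pow A ((\<phi> ^^ d) ?b) n = \<zero>"
    using nilpotent_if_psum_eq_zero[OF torsion_free _ xs psum] a by auto
  interpret g: nonunital_cring_endo A "\<phi> ^^ (d + i)" by (rule endo_funpow)
  \<comment> \<open>Nilpotency of the conjugate puts a power of \<open>a\<close> into the kernel of
    \<open>\<phi> ^^ (d + i)\<close>; stability of the kernels lowers the exponent to
    \<open>i\<close>.\<close>
  have "(\<phi> ^^ (d + i)) (pos_pow A a n) = \<zero>"
    using n g.endo_pos_pow[OF a n(1)] by (simp add: funpow_add)
  then show ?thesis
    using n a kernel_funpow_stable g.mem_a_kernel by blast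
qed

lemma radical_image_subset:
  "radical A (id_minus A \<phi> ` carrier A) \<subseteq> radical A (a_kernel A A (\<phi> ^^ i))"
proof
  interpret f: nonunital_cring_endo A "\<phi> ^^ i" by (rule endo_funpow)
  fix a assume "a \<in> radical A (id_minus A \<phi> ` carrier A)"
  then obtain N where a: "a \<in> carrier A" and N: "N \<ge> 1"
    "\<And>m. m \<ge> N \<Longrightarrow> pos_pow A a m \<in> id_minus A \<phi> ` carrier A"
    unfolding radical_def by blast
  \<comment> \<open>\<open>image_power_in_kernel\<close> needs all positive powers in the image;
    those of the \<open>N\<close>-th power of \<open>a\<close> have exponents
    \<open>N * m \<ge> N\<close>.\<close>
  have "pos_pow A (pos_pow A a N) m \<in> id_minus A \<phi> ` carrier A" if "m \<ge> 1" for m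
    using N that a by (simp add: pos_pow_mult)
  then obtain n where n: "n \<ge> 1" "pos_pow A (pos_pow A a N) n \<in> a_kernel A A (\<phi> ^^ i)"
    using image_power_in_kernel a by (metis pos_pow_closed)
  let ?M = "N * n"
  have M: "?M \<ge> 1" "pos_pow A a ?M \<in> a_kernel A A (\<phi> ^^ i)"
    using n N a by (simp_all add: pos_pow_mult)
  \<comment> \<open>The kernel is an ideal and absorbs the remaining factors. For
    \<open>m = ?M\<close> there is no remaining factor, and no unit to stand for it.\<close>
  have "pos_pow A a m \<in> a_kernel A A (\<phi> ^^ i)" if "m \<ge> ?M" for m
  proof (cases "m = ?M")
    case False
    then have "pos_pow A a m = pos_pow A a ?M \<otimes> pos_pow A a (m - ?M)"
      using pos_pow_add[OF a M(1), of "m - ?M"] that by simp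
    then show ?thesis using M a f.kernel_ideal by simp
  qed (use M in simp)
  then show "a \<in> radical A (a_kernel A A (\<phi> ^^ i))"
    using a M unfolding radical_def by blast
qed

lemma radical_image_eq:
  "radical A (id_minus A \<phi> ` carrier A) = radical A (a_kernel A A (\<phi> ^^ i))"
  by (rule equalityI[OF radical_image_subset radical_mono[OF kernel_funpow_subset_image]])

text \<open>The image of \<delta> need not be an ideal. The radical equality moves high powers of
  \<open>a\<close> into the kernel, which is one; multiplying by \<open>b\<close> and
  \<open>c\<close> there stays inside the image.\<close>

lemma image_mathieu:
  assumes a: "a \<in> carrier A" and b: "b \<in> carrier A" and c: "c \<in> carrier A"
    and "\<forall>m\<ge>1. pos_pow A a m \<in> id_minus A \<phi> ` carrier A"
  shows "\<exists>N\<ge>1. \<forall>m\<ge>N. b \<otimes> pos_pow A a m \<otimes> c \<in> id_minus A \<phi> ` carrier A"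
proof -
  interpret f: nonunital_cring_endo A "\<phi> ^^ i" by (rule endo_funpow)
  have "a \<in> radical A (id_minus A \<phi> ` carrier A)"
    using a assms(4) unfolding radical_def mem_Collect_eq by (intro conjI exI[of _ 1]) simp_all
  then have "a \<in> radical A (a_kernel A A (\<phi> ^^ i))"
    by (rule subsetD[OF radical_image_subset])
  then obtain N where N: "N \<ge> 1" "\<forall>m\<ge>N. pos_pow A a m \<in> a_kernel A A (\<phi> ^^ i)"
    unfolding radical_def by blast
  then have "b \<otimes> pos_pow A a m \<otimes> c \<in> a_kernel A A (\<phi> ^^ i)" if "m \<ge> N" for m
    using that by (intro f.kernel_ideal(1)[OF f.kernel_ideal(2)] b c) simp
  then show ?thesis using N(1) kernel_funpow_subset_image[of i] by (meson subsetD)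
qed

end

end

section \<open>Return to algebras over \<open>R\<close>: the submodule property and the
  theorem\<close>

lemma (in nonunital_comm_algebra) nonunital_cring: "nonunital_cring A"
  by unfold_locales (fact mult_closed mult_assoc mult_comm mult_l_distr)+

lemma algebra_endo_imp_nonunital_cring_endo:
  assumes "nonunital_comm_algebra R A" and "algebra_endo R A \<phi>"
  shows "nonunital_cring_endo A \<phi>"
proof -
  interpret nonunital_cring A
    using assms(1) by (rule nonunital_comm_algebra.nonunital_cring)
  have hom: "\<phi> \<in> hom (add_monoid A) (add_monoid A)" "\<phi> \<in> hom A A"
    using assms(2) by (simp_all add: algebra_endo_def)
  show ?thesis
  proof unfold_locales
    show "\<phi> x \<in> carrier A" if "x \<in> carrier A" for x
      using hom_in_carrier[OF hom(2) that] .
    show "\<phi> (x \<oplus>\<^bsub>A\<^esub> y) = \<phi> x \<oplus>\<^bsub>A\<^esub> \<phi> y" if "x \<in> carrier A" "y \<in> carrier A" for x y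
      using hom_mult[OF hom(1), of x y] that by simp
    show "\<phi> (x \<otimes>\<^bsub>A\<^esub> y) = \<phi> x \<otimes>\<^bsub>A\<^esub> \<phi> y" if "x \<in> carrier A" "y \<in> carrier A" for x y
      using hom_mult[OF hom(2) that] .
  qed
qed

lemma image_id_minus_submodule:
  assumes "nonunital_comm_algebra R A" and "algebra_endo R A \<phi>"
  shows "submodule (id_minus A \<phi> ` carrier A) R A"
proof -
  interpret nonunital_comm_algebra R A by fact
  interpret e: nonunital_cring_endo A \<phi>
    using assms by (rule algebra_endo_imp_nonunital_cring_endo)
  have smult: "id_minus A \<phi> (r \<odot>\<^bsub>A\<^esub> x) = r \<odot>\<^bsub>A\<^esub> id_minus A \<phi> x"
    if "r \<in> carrier R" "x \<in> carrier A" for r x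
    using that assms(2)
    by (simp add: id_minus_def a_minus_def algebra_endo_def smult_r_distr smult_r_minus)
  show ?thesis
  proof (rule submoduleI)
    show "\<zero>\<^bsub>A\<^esub> \<in> id_minus A \<phi> ` carrier A"
      by (rule image_eqI[of _ _ "\<zero>\<^bsub>A\<^esub>"]) simp_all
  next
    fix x assume "x \<in> id_minus A \<phi> ` carrier A"
    then show "\<ominus>\<^bsub>A\<^esub> x \<in> id_minus A \<phi> ` carrier A"
      using e.id_minus_inv by (auto intro!: image_eqI[of _ _ "\<ominus>\<^bsub>A\<^esub> _"])
  next
    fix x y assume "x \<in> id_minus A \<phi> ` carrier A" "y \<in> id_minus A \<phi> ` carrier A"
    then obtain v w where "v \<in> carrier A" "w \<in> carrier A" "x = id_minus A \<phi> v" "y = id_minus A \<phi> w"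
      by blast
    then show "x \<oplus>\<^bsub>A\<^esub> y \<in> id_minus A \<phi> ` carrier A"
      by (intro image_eqI[of _ _ "v \<oplus>\<^bsub>A\<^esub> w"]) (simp_all add: e.id_minus_add)
  next
    fix r x assume "r \<in> carrier R" "x \<in> id_minus A \<phi> ` carrier A"
    then show "r \<odot>\<^bsub>A\<^esub> x \<in> id_minus A \<phi> ` carrier A"
      using smult by (auto intro!: image_eqI[of _ _ "r \<odot>\<^bsub>A\<^esub> _"])
  qed auto
qed

theorem proposition5p4:
  fixes R :: "('r, 's) ring_scheme" and A :: "('r, 'a, 'm) module_scheme"
    and \<phi> \<delta> :: "'a \<Rightarrow> 'a" and i j :: nat
  assumes "nonunital_comm_algebra R A"
    and "torsion_free A"
    and "algebra_endo R A \<phi>"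
    and "1 \<le> i" and "i < j"
    and "\<forall>a \<in> carrier A. (\<phi> ^^ i) a = (\<phi> ^^ j) a"
  defines "\<delta> \<equiv> id_minus A \<phi>"
  shows "radical A (\<delta> ` carrier A) = radical A (a_kernel A A (\<phi> ^^ i))
    \<and> radical A (a_kernel A A (\<phi> ^^ i)) = radical A (Ker_ge1 A \<phi>)
    \<and> mathieu_subspace R A (\<delta> ` carrier A)"
proof -
  interpret nonunital_cring_endo A \<phi>
    using assms(1,3) by (rule algebra_endo_imp_nonunital_cring_endo)
  have per: "\<And>a. a \<in> carrier A \<Longrightarrow> (\<phi> ^^ i) a = (\<phi> ^^ j) a" using assms(6) by blast
  show ?thesis
    unfolding \<delta>_def mathieu_subspace_def
    using radical_image_eq[OF assms(2,5) per] Ker_ge1_eq[OF assms(2,5) per assms(4)]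
      image_mathieu[OF assms(2,5) per] image_id_minus_submodule[OF assms(1,3)]
    by simp
qed

end
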